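(* Let $\epsilon\in\{1,-1\}$ and let $f(x)$ be a polynomial with rational coefficients of degree $m$, where $m\ge 1$ if $\epsilon=-1$ and $m\ge 2$ if $\epsilon=1$. Run Algorithm TCF (defined in the context) on $(f,\epsilon)$. Let $k\ge 1$ be such that the algorithm has completed steps $1,\dots,k-1$, and suppose $N_{k-1}(x)\ne 0$. Put $d=d_k$ and write the unknown monic polynomial of step $k$ as $$b_k(x)=x^{d}+\beta_1x^{d-1}+\beta_2x^{d-2}+\cdots+\beta_d .$$ Then the system of $d+1$ equations used in step $k$ to calculate $a_k,\beta_1,\beta_2,\dots,\beta_d$ is triangular, has non-zero diagonal entries, and has a unique solution. Thus, unless $N_k(x)=0$ at some stage, Algorithm TCF never terminates and determines $a_k$ and $b_k(x)$ for every $k\ge1$. In addition, with $a_k$, $b_k(x)$ so determined, and writing $$E_k(x)=e_0x^m+e_1x^{m-1}+\cdots,\qquad F_k(x)=f_0x^m+f_1x^{m-1}+\cdots,$$ the following hold: (i) $\deg N_k(x)\le m-1$ if $\epsilon=-1$, and $\deg N_k(x)\le m-2$ if $\epsilon=1$; (ii) $\deg E_k(x)=\deg F_k(x)=m$; (iii) $f_0=-\epsilon e_0$, and, if $\epsilon=1$, then $e_0(e_1+f_1)\le 0$.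
   Context: Given constants $a_1,a_2,\dots$ and polynomials $b_1(x),b_2(x),\dots$, define $p_{-1}=1$, $q_{-1}=0$, $p_0=0$, $q_0=1$ and, for $k\ge1$, $p_k(x)=b_k(x)p_{k-1}(x)+a_kp_{k-2}(x)$, $q_k(x)=b_k(x)q_{k-1}(x)+a_kq_{k-2}(x)$. Thus $p_k/q_k$ is the $k$-th convergent of the continued fraction $\cfrac{a_1}{b_1(x)+\cfrac{a_2}{b_2(x)+\cdots}}$. Define $$N_k(x)=q_k(x)q_k(x+1)-f(x)\bigl(p_k(x)q_k(x+1)-\epsilon p_k(x+1)q_k(x)\bigr)\quad (k\ge -1),$$ and for $k\ge0$ $$E_k(x)=q_k(x)q_{k-1}(x+1)-f(x)\bigl(p_k(x)q_{k-1}(x+1)-\epsilon p_{k-1}(x+1)q_k(x)\bigr),$$ $$F_k(x)=q_{k-1}(x)q_k(x+1)-f(x)\bigl(p_{k-1}(x)q_k(x+1)-\epsilon p_k(x+1)q_{k-1}(x)\bigr).$$ In particular $N_{-1}=0$, $N_0=1$, $E_0=\epsilon f$, $F_0=-f$, and for $k\ge1$ $$N_k(x)=b_k(x)b_k(x+1)N_{k-1}(x)+a_k^2N_{k-2}(x)+a_kb_k(x)E_{k-1}(x)+a_kb_k(x+1)F_{k-1}(x).\qquad( * )$$ Algorithm TCF. For $k=1,2,3,\dots$, given $a_j,b_j(x)$ for $j<k$: if $N_{k-1}(x)=0$ identically, stop. Otherwise set $$d_k=\begin{cases}\deg E_{k-1}(x)-\deg N_{k-1}(x),&\epsilon=-1,\\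 \deg E_{k-1}(x)-1-\deg N_{k-1}(x),&\epsilon=1,\end{cases}$$ take $b_k(x)$ to be a monic polynomial of degree $d_k$ with $d_k$ unknown non-leading coefficients, and let $a_k$ be an unknown constant. Require the top $d_k+1$ coefficients of the right-hand side of $( * )$, i.e. the coefficients of $x^{2d_k+q},x^{2d_k+q-1},\dots,x^{d_k+q}$ with $q=\deg N_{k-1}(x)$, to be zero. This gives $d_k+1$ equations in the $d_k+1$ unknowns (all unknowns rational). If the system has a unique solution, use it to define $a_k$ and $b_k(x)$ and continue with $k+1$; if it has no solution or several, the algorithm terminates. "Triangular with non-zero diagonal entries" means: with the equations taken in order of decreasing power of $x$, the first equation is linear in $a_k$, involves no other unknown, and has non-zero coefficient of $a_k$; and for $i=1,\dots,d$ the $(i+1)$-st equation involves only $a_k,\beta_1,\dots,\beta_i$ and, once $a_k,\beta_1,\dots,\beta_{i-1}$ have the values determined by the previous equations, it is linear in $\beta_i$ with non-zero coefficient. The zero polynomial has degree $-\infty$. *)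

theory Defs
  imports "HOL-Computational_Algebra.Polynomial"
begin

abbreviation shift :: "rat poly \<Rightarrow> rat poly" where
  "shift g \<equiv> pcompose g [:1, 1:]"   \<comment> \<open>\<open>g(x) \<mapsto> g(x + 1)\<close>\<close>

text \<open>
  Numerators and denominators of the convergents carry an integer index because the
  recursion starts at \<open>k = -1\<close>; the equations for \<open>k < -1\<close> are junk values, never used.
  The values \<open>a 0\<close> and \<open>b 0\<close> are never used either.
\<close>

function cf_p :: "(nat \<Rightarrow> rat) \<Rightarrow> (nat \<Rightarrow> rat poly) \<Rightarrow> int \<Rightarrow> rat poly" where
  "cf_p a b k = (if k \<le> -1 then 1 else if k = 0 then 0
     else b (nat k) * cf_p a b (k - 1) + smult (a (nat k)) (cf_p a b (k - 2)))"
  by pat_completeness auto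
termination by (relation "measure (\<lambda>(a, b, k). nat (k + 1))") auto

function cf_q :: "(nat \<Rightarrow> rat) \<Rightarrow> (nat \<Rightarrow> rat poly) \<Rightarrow> int \<Rightarrow> rat poly" where
  "cf_q a b k = (if k \<le> -1 then 0 else if k = 0 then 1
     else b (nat k) * cf_q a b (k - 1) + smult (a (nat k)) (cf_q a b (k - 2)))"
  by pat_completeness auto
termination by (relation "measure (\<lambda>(a, b, k). nat (k + 1))") auto

declare cf_p.simps [simp del] cf_q.simps [simp del]

definition cf_N :: "rat \<Rightarrow> rat poly \<Rightarrow> (nat \<Rightarrow> rat) \<Rightarrow> (nat \<Rightarrow> rat poly) \<Rightarrow> int \<Rightarrow> rat poly" where
  "cf_N \<epsilon> f a b k = cf_q a b k * shift (cf_q a b k)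
     - f * (cf_p a b k * shift (cf_q a b k) - smult \<epsilon> (shift (cf_p a b k) * cf_q a b k))"

definition cf_E :: "rat \<Rightarrow> rat poly \<Rightarrow> (nat \<Rightarrow> rat) \<Rightarrow> (nat \<Rightarrow> rat poly) \<Rightarrow> int \<Rightarrow> rat poly" where
  "cf_E \<epsilon> f a b k = cf_q a b k * shift (cf_q a b (k - 1))
     - f * (cf_p a b k * shift (cf_q a b (k - 1))
            - smult \<epsilon> (shift (cf_p a b (k - 1)) * cf_q a b k))"

definition cf_F :: "rat \<Rightarrow> rat poly \<Rightarrow> (nat \<Rightarrow> rat) \<Rightarrow> (nat \<Rightarrow> rat poly) \<Rightarrow> int \<Rightarrow> rat poly" where
  "cf_F \<epsilon> f a b k = cf_q a b (k - 1) * shift (cf_q a b k)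
     - f * (cf_p a b (k - 1) * shift (cf_q a b k)
            - smult \<epsilon> (shift (cf_p a b k) * cf_q a b (k - 1)))"

text \<open>
  The degree \<open>d\<^sub>k\<close> is an integer, since a priori the difference may be negative. The
  formula gives \<open>d\<^sub>k\<close> only when \<open>E\<^sub>k\<^sub>-\<^sub>1\<close> and \<open>N\<^sub>k\<^sub>-\<^sub>1\<close> are non-zero (\<open>degree 0 = 0\<close> here,
  not \<open>-\<infinity>\<close>).
\<close>

definition tcf_deg :: "rat \<Rightarrow> rat poly \<Rightarrow> (nat \<Rightarrow> rat) \<Rightarrow> (nat \<Rightarrow> rat poly) \<Rightarrow> nat \<Rightarrow> int" where
  "tcf_deg \<epsilon> f a b k =
     (if \<epsilon> = -1 then int (degree (cf_E \<epsilon> f a b (int k - 1))) - int (degree (cf_N \<epsilon> f a b (int k - 1)))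
      else int (degree (cf_E \<epsilon> f a b (int k - 1))) - 1 - int (degree (cf_N \<epsilon> f a b (int k - 1))))"

definition unknown_monic :: "nat \<Rightarrow> (nat \<Rightarrow> rat) \<Rightarrow> rat poly" where
  "unknown_monic d \<beta> = monom 1 d + (\<Sum>i = 1..d. monom (\<beta> i) (d - i))"

text \<open>
  The right-hand side of the recurrence for \<open>N\<^sub>k\<close>, with \<open>\<alpha>\<close> and \<open>B\<close> in place of \<open>a\<^sub>k\<close> and
  \<open>b\<^sub>k\<close>; it uses \<open>a\<^sub>j\<close> and \<open>b\<^sub>j\<close> for \<open>j < k\<close> only.
\<close>

definition tcf_rhs :: "rat \<Rightarrow> rat poly \<Rightarrow> (nat \<Rightarrow> rat) \<Rightarrow> (nat \<Rightarrow> rat poly) \<Rightarrow> nat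
    \<Rightarrow> rat \<Rightarrow> rat poly \<Rightarrow> rat poly" where
  "tcf_rhs \<epsilon> f a b k \<alpha> B =
     B * shift B * cf_N \<epsilon> f a b (int k - 1)
     + smult (\<alpha>\<^sup>2) (cf_N \<epsilon> f a b (int k - 2))
     + smult \<alpha> (B * cf_E \<epsilon> f a b (int k - 1))
     + smult \<alpha> (shift B * cf_F \<epsilon> f a b (int k - 1))"

text \<open>
  Left-hand side of the equation number \<open>i + 1\<close> of step \<open>k\<close>, for \<open>i = 0, \<dots>, d\<^sub>k\<close>: the
  coefficient of \<open>x\<close> to the power \<open>2 d\<^sub>k + q - i\<close>.
\<close>

definition tcf_eq :: "rat \<Rightarrow> rat poly \<Rightarrow> (nat \<Rightarrow> rat) \<Rightarrow> (nat \<Rightarrow> rat poly) \<Rightarrow> nat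
    \<Rightarrow> nat \<Rightarrow> rat \<Rightarrow> (nat \<Rightarrow> rat) \<Rightarrow> rat" where
  "tcf_eq \<epsilon> f a b k i \<alpha> \<beta> =
     (let d = nat (tcf_deg \<epsilon> f a b k); q = degree (cf_N \<epsilon> f a b (int k - 1))
      in coeff (tcf_rhs \<epsilon> f a b k \<alpha> (unknown_monic d \<beta>)) (2 * d + q - i))"

text \<open>
  If \<open>E\<^sub>k\<^sub>-\<^sub>1\<close> is zero or \<open>d\<^sub>k\<close> is negative, there is no monic polynomial of degree \<open>d\<^sub>k\<close> and
  hence no solution. The irrelevant entries of \<open>\<beta>\<close> are normalised to zero, so that
  uniqueness of the pair \<open>(\<alpha>, \<beta>)\<close> is uniqueness of \<open>\<alpha>, \<beta>\<^sub>1, \<dots>, \<beta>\<^sub>d\<close>.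
\<close>

definition tcf_solution :: "rat \<Rightarrow> rat poly \<Rightarrow> (nat \<Rightarrow> rat) \<Rightarrow> (nat \<Rightarrow> rat poly) \<Rightarrow> nat
    \<Rightarrow> rat \<times> (nat \<Rightarrow> rat) \<Rightarrow> bool" where
  "tcf_solution \<epsilon> f a b k = (\<lambda>(\<alpha>, \<beta>).
     cf_E \<epsilon> f a b (int k - 1) \<noteq> 0 \<and> tcf_deg \<epsilon> f a b k \<ge> 0
     \<and> (\<forall>i. i \<notin> {1..nat (tcf_deg \<epsilon> f a b k)} \<longrightarrow> \<beta> i = 0)
     \<and> (\<forall>i \<le> nat (tcf_deg \<epsilon> f a b k). tcf_eq \<epsilon> f a b k i \<alpha> \<beta> = 0))"

text \<open>
  \<open>Running a b\<close>: all steps so far have succeeded; \<open>Stopped\<close>: some \<open>N\<^sub>k\<^sub>-\<^sub>1\<close> was found to be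
  zero; \<open>Failed\<close>: some system had no solution or several. In the state \<open>Running a b\<close> after
  \<open>n\<close> steps, only \<open>a k\<close> and \<open>b k\<close> with \<open>1 \<le> k \<le> n\<close> are meaningful.
\<close>

datatype tcf_state = Running "nat \<Rightarrow> rat" "nat \<Rightarrow> rat poly" | Stopped | Failed

fun tcf_step :: "rat \<Rightarrow> rat poly \<Rightarrow> nat \<Rightarrow> tcf_state \<Rightarrow> tcf_state" where
  "tcf_step \<epsilon> f k (Running a b) =
     (if cf_N \<epsilon> f a b (int k - 1) = 0 then Stopped
      else if \<exists>!s. tcf_solution \<epsilon> f a b k s then
        (case (THE s. tcf_solution \<epsilon> f a b k s) of (\<alpha>, \<beta>) \<Rightarrow>
           Running (a(k := \<alpha>)) (b(k := unknown_monic (nat (tcf_deg \<epsilon> f a b k)) \<beta>)))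
      else Failed)"
| "tcf_step \<epsilon> f k Stopped = Stopped"
| "tcf_step \<epsilon> f k Failed = Failed"

primrec tcf :: "rat \<Rightarrow> rat poly \<Rightarrow> nat \<Rightarrow> tcf_state" where
  "tcf \<epsilon> f 0 = Running (\<lambda>_. 0) (\<lambda>_. 0)"
| "tcf \<epsilon> f (Suc n) = tcf_step \<epsilon> f (Suc n) (tcf \<epsilon> f n)"

text \<open>
  \<open>eq i \<alpha> \<beta> = 0\<close> is equation number \<open>i + 1\<close>. Linear means of the form \<open>c t + c\<^sub>0\<close> with
  constants \<open>c\<close> and \<open>c\<^sub>0\<close>. As \<open>\<rat>\<close> is infinite, polynomials in the unknowns may be treated
  as functions.
\<close>

definition triangular_nonzero_diagonal ::
    "nat \<Rightarrow> (nat \<Rightarrow> rat \<Rightarrow> (nat \<Rightarrow> rat) \<Rightarrow> rat) \<Rightarrow> bool" where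
  "triangular_nonzero_diagonal d eq \<longleftrightarrow>
     (\<exists>c c\<^sub>0. c \<noteq> 0 \<and> (\<forall>\<alpha> \<beta>. eq 0 \<alpha> \<beta> = c * \<alpha> + c\<^sub>0))
     \<and> (\<forall>i \<in> {1..d}.
          (\<forall>\<alpha> \<beta> \<beta>'. (\<forall>j \<in> {1..i}. \<beta> j = \<beta>' j) \<longrightarrow> eq i \<alpha> \<beta> = eq i \<alpha> \<beta>')
          \<and> (\<exists>c c\<^sub>0. c \<noteq> 0 \<and>
               (\<forall>\<alpha> \<beta>. (\<forall>j < i. eq j \<alpha> \<beta> = 0) \<longrightarrow> eq i \<alpha> \<beta> = c * \<beta> i + c\<^sub>0)))"

end

theory Submission
  imports Defs
begin

text \<open>
  The shape of \<open>E\<^sub>k\<close>, \<open>F\<^sub>k\<close> and the degree bound on \<open>N\<^sub>k\<close> propagate from step to step through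
  \<open>E\<^sub>k = b\<^sub>k N\<^sub>k\<^sub>-\<^sub>1 + a\<^sub>k F\<^sub>k\<^sub>-\<^sub>1\<close> and \<open>F\<^sub>k = b\<^sub>k(x + 1) N\<^sub>k\<^sub>-\<^sub>1 + a\<^sub>k E\<^sub>k\<^sub>-\<^sub>1\<close>. In step \<open>k\<close> the term
  \<open>a\<^sub>k\<^sup>2 N\<^sub>k\<^sub>-\<^sub>2\<close> has too small a degree to enter the equations, so with \<open>\<nu>\<close> the leading
  coefficient of \<open>N\<^sub>k\<^sub>-\<^sub>1\<close> the first one reads \<open>\<nu> + a\<^sub>k s(d) = 0\<close> and \<open>\<beta>\<^sub>i\<close> has the coefficient
  \<open>2\<nu> + a\<^sub>k s(d - i) = a\<^sub>k (s(d - i) - 2 s(d))\<close> in equation \<open>i + 1\<close>. Here \<open>s(r)\<close> is \<open>2 e\<^sub>0\<close> if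
  \<open>\<epsilon> = -1\<close> and \<open>e\<^sub>1 + f\<^sub>1 - r e\<^sub>0\<close> if \<open>\<epsilon> = 1\<close>, where \<open>e\<^sub>i\<close>, \<open>f\<^sub>i\<close> are the coefficients of
  \<open>E\<^sub>k\<^sub>-\<^sub>1\<close>, \<open>F\<^sub>k\<^sub>-\<^sub>1\<close>. In the second case the sign condition \<open>e\<^sub>0 (e\<^sub>1 + f\<^sub>1) \<le> 0\<close> keeps \<open>s(d)\<close>
  and \<open>s(d - i) - 2 s(d) = (d + i) e\<^sub>0 - (e\<^sub>1 + f\<^sub>1)\<close> away from zero.
\<close>

section \<open>Coefficients of shifts and products\<close>

lemma degree_shift [simp]: "degree (shift p) = degree p"
  by (simp add: degree_pcompose)

lemma coeff_shift_pCons_Suc: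
  "coeff (shift (pCons c p)) (Suc n) = coeff (shift p) (Suc n) + coeff (shift p) n"
  by (simp add: pcompose_pCons)

lemma coeff_shift_top: "degree p \<le> n \<Longrightarrow> coeff (shift p) n = coeff p n"
proof (induction p arbitrary: n)
  case 0
  then show ?case by simp
next
  case (pCons c p)
  show ?case
  proof (cases "p = 0")
    case True
    then show ?thesis by (simp add: pcompose_pCons)
  next
    case False
    with pCons.prems obtain n' where n: "n = Suc n'" "degree p \<le> n'"
      by (cases n) auto
    then have "coeff (shift p) (Suc n') = 0"
      by (intro coeff_eq_0) simp
    with n pCons.IH show ?thesis
      by (simp add: coeff_shift_pCons_Suc)
  qed
qed

text \<open>In (x + 1)^(n + 1) the power x^n occurs n + 1 times, and p contains no power of x above
  x^(n + 1).\<close>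

lemma coeff_shift_second:
  "degree p \<le> Suc n \<Longrightarrow> coeff (shift p) n = coeff p n + of_nat (Suc n) * coeff p (Suc n)"
proof (induction p arbitrary: n)
  case 0
  then show ?case by simp
next
  case (pCons c p)
  have deg: "degree p \<le> n"
    using pCons.prems by (cases "p = 0") auto
  show ?case
  proof (cases n)
    case 0
    with deg show ?thesis
      using coeff_shift_top[of p 0] by (simp add: pcompose_pCons)
  next
    case (Suc n')
    with deg have "coeff (shift p) (Suc n') = coeff p (Suc n')"
      "coeff (shift p) n' = coeff p n' + of_nat (Suc n') * coeff p (Suc n')"
      using pCons.IH[of n'] by (auto intro: coeff_shift_top)
    with Suc show ?thesis
      by (simp add: coeff_shift_pCons_Suc algebra_simps)
  qed
qed

text \<open>Degree bounds instead of exact degrees admit factors whose formal top coefficient may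
  vanish, such as the difference of two candidates for \<open>b\<^sub>k\<close>.\<close>

lemma coeff_mult_top:
  fixes p g :: "'a :: comm_semiring_0 poly"
  assumes "degree p \<le> r" "degree g \<le> n"
  shows "coeff (p * g) (r + n) = coeff p r * coeff g n"
proof -
  have "coeff (p * g) (r + n) = (\<Sum>i\<le>r + n. coeff p i * coeff g (r + n - i))"
    by (rule coeff_mult)
  also have "\<dots> = (\<Sum>i\<in>{r}. coeff p i * coeff g (r + n - i))"
  proof (rule sum.mono_neutral_right)
    show "\<forall>i\<in>{..r + n} - {r}. coeff p i * coeff g (r + n - i) = 0"
    proof
      fix i assume "i \<in> {..r + n} - {r}"
      then have "r < i \<or> n < r + n - i" by auto
      with assms have "coeff p i = 0 \<or> coeff g (r + n - i) = 0"
        by (meson coeff_eq_0 le_less_trans)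
      then show "coeff p i * coeff g (r + n - i) = 0" by auto
    qed
  qed auto
  finally show ?thesis by simp
qed

lemma coeff_mult_second:
  fixes p g :: "'a :: comm_semiring_0 poly"
  assumes "degree p \<le> Suc r" "degree g \<le> Suc n"
  shows "coeff (p * g) (Suc (r + n)) = coeff p r * coeff g (Suc n) + coeff p (Suc r) * coeff g n"
proof -
  let ?t = "\<lambda>i. coeff p i * coeff g (Suc (r + n) - i)"
  have "coeff (p * g) (Suc (r + n)) = (\<Sum>i\<le>Suc (r + n). ?t i)"
    by (rule coeff_mult)
  also have "\<dots> = (\<Sum>i\<in>{r, Suc r}. ?t i)"
  proof (rule sum.mono_neutral_right)
    show "\<forall>i\<in>{..Suc (r + n)} - {r, Suc r}. ?t i = 0"
    proof
      fix i assume "i \<in> {..Suc (r + n)} - {r, Suc r}"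
      then have "Suc r < i \<or> Suc n < Suc (r + n) - i" by auto
      with assms have "coeff p i = 0 \<or> coeff g (Suc (r + n) - i) = 0"
        by (meson coeff_eq_0 le_less_trans)
      then show "?t i = 0" by auto
    qed
  qed auto
  finally show ?thesis by (simp add: Suc_diff_le)
qed

lemma coeff_mult_shift_add_top:
  assumes "degree D \<le> r" "degree E \<le> m" "degree F \<le> m"
  shows "coeff (D * E) (r + m) + coeff (shift D * F) (r + m) = coeff D r * (coeff E m + coeff F m)"
  using assms by (simp add: coeff_mult_top coeff_shift_top distrib_left)

text \<open>For \<epsilon> = 1 the top coefficients of E and F are opposite, so the contributions of
  the coefficient of D at r - 1 cancel. What remains is the r-fold top coefficient that the shift
  adds, whence the term with \<open>of_nat r\<close>.\<close>

lemma coeff_mult_shift_add_second: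
  assumes "degree D \<le> r" "degree E \<le> Suc m" "degree F \<le> Suc m"
    and "coeff F (Suc m) = - coeff E (Suc m)"
  shows "coeff (D * E) (r + m) + coeff (shift D * F) (r + m)
           = coeff D r * (coeff E m + coeff F m - of_nat r * coeff E (Suc m))"
proof (cases r)
  \<comment> \<open>There is no coefficient of D below index 0, so the product formula for the
    second coefficient does not apply; D is a constant.\<close>
  case 0
  with assms(1) have "degree D = 0" by simp
  then obtain c where "D = [:c:]" by (metis degree_eq_zeroE)
  with 0 show ?thesis by (simp add: algebra_simps)
next
  case (Suc r')
  with assms have "coeff (D * E) (r + m) = coeff D r' * coeff E (Suc m) + coeff D r * coeff E m"
    "coeff (shift D * F) (r + m)
       = (coeff D r' + of_nat r * coeff D r) * coeff F (Suc m) + coeff D r * coeff F m"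
    by (simp_all add: coeff_mult_second coeff_shift_top coeff_shift_second)
  with assms(4) show ?thesis
    by (simp add: algebra_simps)
qed

lemma coeff_unknown_monic:
  "coeff (unknown_monic d \<beta>) n = (if n = d then 1 else if n < d then \<beta> (d - n) else 0)"
proof -
  have "(\<Sum>i = 1..d. coeff (monom (\<beta> i) (d - i)) n)
      = (\<Sum>i = 1..d. if i = d - n then if n < d then \<beta> i else 0 else 0)"
    by (intro sum.cong) auto
  also have "\<dots> = (if n < d then \<beta> (d - n) else 0)"
    by (auto simp: sum.delta)
  finally show ?thesis
    by (auto simp: unknown_monic_def coeff_sum)
qed

lemma degree_unknown_monic [simp]: "degree (unknown_monic d \<beta>) = d"
proof (rule antisym)
  show "degree (unknown_monic d \<beta>) \<le> d"
    by (rule degree_le) (simp add: coeff_unknown_monic)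
  show "d \<le> degree (unknown_monic d \<beta>)"
    by (rule le_degree) (simp add: coeff_unknown_monic)
qed

section \<open>Triangular systems\<close>

text \<open>Differences of two candidates suffice: \<open>diff\<close> gives dependence on the right
  unknowns when \<beta> and \<beta>' also agree at i, and linearity when one of the two is a fixed
  reference solution. The constant terms never have to be computed.\<close>

lemma triangularI:
  fixes eq :: "nat \<Rightarrow> rat \<Rightarrow> (nat \<Rightarrow> rat) \<Rightarrow> rat"
  assumes first: "\<And>\<alpha> \<beta>. eq 0 \<alpha> \<beta> = c * \<alpha> + c\<^sub>0" and c: "c \<noteq> 0"
    and diff: "\<And>i \<alpha> \<beta> \<beta>'. \<lbrakk>i \<in> {1..d}; \<And>j. j \<in> {1..<i} \<Longrightarrow> \<beta> j = \<beta>' j\<rbrakk>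
                 \<Longrightarrow> eq i \<alpha> \<beta> - eq i \<alpha> \<beta>' = g i \<alpha> * (\<beta> i - \<beta>' i)"
    and g: "\<And>i \<alpha>. \<lbrakk>i \<in> {1..d}; c * \<alpha> + c\<^sub>0 = 0\<rbrakk> \<Longrightarrow> g i \<alpha> \<noteq> 0"
  shows "triangular_nonzero_diagonal d eq"
proof -
  have dep: "eq i \<alpha> \<beta> = eq i \<alpha> \<beta>'"
    if "i \<in> {1..d}" "\<forall>j \<in> {1..i}. \<beta> j = \<beta>' j" for i \<alpha> \<beta> \<beta>'
    using diff[of i \<beta> \<beta>' \<alpha>] that by auto
  have lin: "\<exists>c c\<^sub>0. c \<noteq> 0 \<and> (\<forall>\<alpha> \<beta>. (\<forall>j < i. eq j \<alpha> \<beta> = 0) \<longrightarrow> eq i \<alpha> \<beta> = c * \<beta> i + c\<^sub>0)"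
    if i: "i \<in> {1..d}" for i
  proof (cases "\<exists>\<alpha> \<beta>. \<forall>j < i. eq j \<alpha> \<beta> = 0")
    case False
    \<comment> \<open>No pair satisfies the earlier equations, so linearity is vacuous and any
      non-zero \<open>c\<close> will do.\<close>
    then show ?thesis by (intro exI[of _ 1] exI[of _ 0]) auto
  next
    case True
    \<comment> \<open>A reference solution of the earlier equations. They fix \<alpha> and the
      earlier entries of \<beta>, so every other solution agrees with it there and
      \<open>diff\<close> applies.\<close>
    then obtain \<alpha>' \<beta>' where sol': "eq j \<alpha>' \<beta>' = 0" if "j < i" for j by blast
    have zero': "c * \<alpha>' + c\<^sub>0 = 0"
      using sol'[of 0] i first by simp
    have *: "eq i \<alpha> \<beta> = g i \<alpha>' * \<beta> i + (eq i \<alpha>' \<beta>' - g i \<alpha>' * \<beta>' i)"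
      if sol: "\<forall>j < i. eq j \<alpha> \<beta> = 0" for \<alpha> \<beta>
    proof -
      have "c * \<alpha> + c\<^sub>0 = 0" using sol i first by force
      with zero' c have \<alpha>: "\<alpha> = \<alpha>'"
        by (metis add_right_cancel mult_left_cancel)
      \<comment> \<open>Once agreement holds below j, subtracting equation j for the two vectors
        leaves \<open>g j \<alpha>' * (\<beta> j - \<beta>' j) = 0\<close>.\<close>
      have "j \<in> {1..<i} \<longrightarrow> \<beta> j = \<beta>' j" for j
      proof (induction j rule: less_induct)
        case (less j)
        show ?case
        proof
          assume j: "j \<in> {1..<i}"
          have "eq j \<alpha>' \<beta> - eq j \<alpha>' \<beta>' = g j \<alpha>' * (\<beta> j - \<beta>' j)"
            using i j less by (intro diff) auto
          moreover have "g j \<alpha>' \<noteq> 0" using i j zero' by (intro g) auto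
          ultimately show "\<beta> j = \<beta>' j" using sol sol' \<alpha> j by auto
        qed
      qed
      with diff[OF i, of \<beta> \<beta>' \<alpha>'] \<alpha> show ?thesis
        by (simp add: algebra_simps)
    qed
    with g[OF i zero'] show ?thesis by blast
  qed
  have "\<exists>c c\<^sub>0. c \<noteq> 0 \<and> (\<forall>\<alpha> \<beta>. eq 0 \<alpha> \<beta> = c * \<alpha> + c\<^sub>0)"
    using first c by blast
  with dep lin show ?thesis
    unfolding triangular_nonzero_diagonal_def by blast
qed

lemma triangular_dependence:
  assumes "triangular_nonzero_diagonal d eq" "i \<le> d" "\<And>j. j \<in> {1..i} \<Longrightarrow> \<beta> j = \<beta>' j"
  shows "eq i \<alpha> \<beta> = eq i \<alpha> \<beta>'"
proof (cases "i = 0")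
  case True
  then show ?thesis
    using assms(1) by (auto simp: triangular_nonzero_diagonal_def)
next
  case False
  then have "i \<in> {1..d}" using assms(2) by auto
  then show ?thesis
    using assms(1,3) unfolding triangular_nonzero_diagonal_def by blast
qed

text \<open>Forward substitution: the next equation is solved by changing only its diagonal unknown,
  on which the earlier equations do not depend.\<close>

lemma triangular_prefix_solution:
  assumes tri: "triangular_nonzero_diagonal d eq" and "n \<le> d"
  shows "\<exists>\<alpha> \<beta>. \<forall>i\<le>n. eq i \<alpha> \<beta> = 0"
  using \<open>n \<le> d\<close>
proof (induction n)
  case 0
  obtain c c\<^sub>0 where c: "c \<noteq> 0" "\<And>\<alpha> \<beta>. eq 0 \<alpha> \<beta> = c * \<alpha> + c\<^sub>0"
    using tri unfolding triangular_nonzero_diagonal_def by blast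
  then have "eq 0 (- c\<^sub>0 / c) \<beta> = 0" for \<beta> by simp
  then show ?case by auto
next
  case (Suc n)
  then obtain \<alpha> \<beta> where sol: "\<forall>i\<le>n. eq i \<alpha> \<beta> = 0" by auto
  have "Suc n \<in> {1..d}" using Suc.prems by auto
  then obtain c c\<^sub>0 where c: "c \<noteq> 0"
    "\<And>\<alpha> \<beta>. \<forall>j<Suc n. eq j \<alpha> \<beta> = 0 \<Longrightarrow> eq (Suc n) \<alpha> \<beta> = c * \<beta> (Suc n) + c\<^sub>0"
    using tri unfolding triangular_nonzero_diagonal_def by blast
  define \<beta>' where "\<beta>' = \<beta>(Suc n := - c\<^sub>0 / c)"
  have sol': "eq i \<alpha> \<beta>' = 0" if "i \<le> n" for i
  proof -
    have "eq i \<alpha> \<beta>' = eq i \<alpha> \<beta>"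
      using that Suc.prems by (intro triangular_dependence[OF tri]) (auto simp: \<beta>'_def)
    with sol that show ?thesis by simp
  qed
  then have "eq (Suc n) \<alpha> \<beta>' = c * \<beta>' (Suc n) + c\<^sub>0"
    by (intro c) auto
  then have "eq (Suc n) \<alpha> \<beta>' = 0"
    using c(1) by (simp add: \<beta>'_def)
  with sol' show ?case by (metis le_Suc_eq)
qed

lemma triangular_unique_solution:
  assumes tri: "triangular_nonzero_diagonal d eq"
  shows "\<exists>!s. case s of (\<alpha>, \<beta>) \<Rightarrow>
           (\<forall>i. i \<notin> {1..d} \<longrightarrow> \<beta> i = 0) \<and> (\<forall>i\<le>d. eq i \<alpha> \<beta> = 0)"
proof -
  obtain \<alpha> \<beta> where sol: "\<forall>i\<le>d. eq i \<alpha> \<beta> = 0"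
    using triangular_prefix_solution[OF tri order_refl] by blast
  \<comment> \<open>Clearing the entries outside 1..d is harmless by
    \<open>triangular_dependence\<close> and matches the normalisation in
    \<open>tcf_solution\<close>.\<close>
  define \<beta>' where "\<beta>' i = (if i \<in> {1..d} then \<beta> i else 0)" for i
  have sol': "eq i \<alpha> \<beta>' = 0" if "i \<le> d" for i
  proof -
    have "eq i \<alpha> \<beta>' = eq i \<alpha> \<beta>"
      using that by (intro triangular_dependence[OF tri]) (auto simp: \<beta>'_def)
    with sol that show ?thesis by simp
  qed
  have uniq: "\<alpha>1 = \<alpha>2 \<and> \<beta>1 = \<beta>2"
    if out: "\<forall>i. i \<notin> {1..d} \<longrightarrow> \<beta>1 i = 0" "\<forall>i. i \<notin> {1..d} \<longrightarrow> \<beta>2 i = 0"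
      and z: "\<forall>i\<le>d. eq i \<alpha>1 \<beta>1 = 0" "\<forall>i\<le>d. eq i \<alpha>2 \<beta>2 = 0" for \<alpha>1 \<alpha>2 \<beta>1 \<beta>2
  proof -
    obtain c c\<^sub>0 where c: "c \<noteq> 0" "\<And>\<alpha> \<beta>. eq 0 \<alpha> \<beta> = c * \<alpha> + c\<^sub>0"
      using tri unfolding triangular_nonzero_diagonal_def by blast
    have "c * \<alpha>1 + c\<^sub>0 = c * \<alpha>2 + c\<^sub>0"
      using z c(2) by (metis le0)
    with c(1) have "\<alpha>1 = \<alpha>2" by simp
    moreover have "\<beta>1 i = \<beta>2 i" for i
    proof (cases "i \<in> {1..d}")
      case True
      then obtain c c\<^sub>0 where c: "c \<noteq> 0"
        "\<And>\<alpha> \<beta>. \<forall>j<i. eq j \<alpha> \<beta> = 0 \<Longrightarrow> eq i \<alpha> \<beta> = c * \<beta> i + c\<^sub>0"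
        using tri unfolding triangular_nonzero_diagonal_def by blast
      \<comment> \<open>The same \<open>c\<close> and \<open>c\<^sub>0\<close> serve every solution
        of the earlier equations, so the two solutions can be compared at i without knowing that
        they agree below i.\<close>
      have "c * \<beta>1 i + c\<^sub>0 = eq i \<alpha>1 \<beta>1" "c * \<beta>2 i + c\<^sub>0 = eq i \<alpha>2 \<beta>2"
        using c(2)[of \<alpha>1 \<beta>1] c(2)[of \<alpha>2 \<beta>2] z True by auto
      moreover have "eq i \<alpha>1 \<beta>1 = 0" "eq i \<alpha>2 \<beta>2 = 0" using z True by auto
      ultimately have "c * \<beta>1 i = c * \<beta>2 i" by linarith
      with c(1) show ?thesis by simp
    qed (use out in simp)
    ultimately show ?thesis by auto
  qed
  show ?thesis
  proof (rule ex1I[of _ "(\<alpha>, \<beta>')"])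
    show "case (\<alpha>, \<beta>') of (\<alpha>, \<beta>) \<Rightarrow>
            (\<forall>i. i \<notin> {1..d} \<longrightarrow> \<beta> i = 0) \<and> (\<forall>i\<le>d. eq i \<alpha> \<beta> = 0)"
      using sol' by (auto simp: \<beta>'_def)
  next
    fix s assume s: "case s of (\<alpha>, \<beta>) \<Rightarrow>
            (\<forall>i. i \<notin> {1..d} \<longrightarrow> \<beta> i = 0) \<and> (\<forall>i\<le>d. eq i \<alpha> \<beta> = 0)"
    obtain \<alpha>2 \<beta>2 where "s = (\<alpha>2, \<beta>2)" by fastforce
    moreover have "\<alpha>2 = \<alpha> \<and> \<beta>2 = \<beta>'"
      by (rule uniq) (use s sol' \<open>s = (\<alpha>2, \<beta>2)\<close> in \<open>simp_all add: \<beta>'_def\<close>)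
    ultimately show "s = (\<alpha>, \<beta>')" by simp
  qed
qed

section \<open>One step of the algorithm\<close>

text \<open>
  \<open>N\<close> and \<open>N'\<close> stand for \<open>N\<^sub>k\<^sub>-\<^sub>1\<close> and \<open>N\<^sub>k\<^sub>-\<^sub>2\<close>. The locale is used with \<open>M = m\<close> if \<open>\<epsilon> = -1\<close>, and
  with \<open>M = m - 1\<close> if \<open>\<epsilon> = 1\<close>, since then the top coefficient of \<open>D E + D(x + 1) F\<close> cancels.
\<close>

locale step_system =
  fixes N N' E F :: "rat poly" and d M :: nat and s :: "nat \<Rightarrow> rat"
  assumes N_nonzero: "N \<noteq> 0"
    and deg_N: "d + degree N = M"
    and deg_N': "degree N' < M"
    and top: "\<And>D r. degree D \<le> r \<Longrightarrow> coeff (D * E) (r + M) + coeff (shift D * F) (r + M) = coeff D r * s r"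
    and s_d: "s d \<noteq> 0"
    and s_diff: "\<And>i. i \<in> {1..d} \<Longrightarrow> s (d - i) \<noteq> 2 * s d"
begin

definition rhs :: "rat \<Rightarrow> rat poly \<Rightarrow> rat poly" where
  "rhs \<alpha> B = B * shift B * N + smult (\<alpha>\<^sup>2) N' + smult \<alpha> (B * E) + smult \<alpha> (shift B * F)"

lemma rhs_eq: "rhs \<alpha> B = B * shift B * N + smult (\<alpha>\<^sup>2) N' + smult \<alpha> (B * E + shift B * F)"
  by (simp add: rhs_def smult_add_right)

definition eq :: "nat \<Rightarrow> rat \<Rightarrow> (nat \<Rightarrow> rat) \<Rightarrow> rat" where
  "eq i \<alpha> \<beta> = coeff (rhs \<alpha> (unknown_monic d \<beta>)) (2 * d + degree N - i)"

text \<open>As M = d + deg N, the quadratic term reaches at most x^(d + M). The case r = d yields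
  the first equation; r > d serves to show that nothing survives above it.\<close>

lemma coeff_rhs_top:
  assumes B: "degree B \<le> d" and r: "d \<le> r"
  shows "coeff (rhs \<alpha> B) (r + M)
           = (if r = d then (coeff B d)\<^sup>2 * lead_coeff N else 0) + \<alpha> * coeff B r * s r"
proof -
  have "coeff N' (r + M) = 0" using deg_N' by (intro coeff_eq_0) simp
  moreover have "coeff (B * shift B * N) (r + M) = (if r = d then (coeff B d)\<^sup>2 * lead_coeff N else 0)"
  proof (cases "r = d")
    case True
    have "degree (B * shift B) \<le> d + d"
      using B degree_mult_le[of B "shift B"] by simp
    then have "coeff (B * shift B * N) (d + d + degree N) = coeff (B * shift B) (d + d) * lead_coeff N"
      by (intro coeff_mult_top) auto
    also have "coeff (B * shift B) (d + d) = (coeff B d)\<^sup>2"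
      using B by (simp add: coeff_mult_top coeff_shift_top power2_eq_square)
    finally show ?thesis using True deg_N by (simp add: add.assoc)
  next
    case False
    have "degree (B * shift B * N) \<le> d + d + degree N"
      using B degree_mult_le[of B "shift B"] degree_mult_le[of "B * shift B" N] by simp
    then have "degree (B * shift B * N) < r + M"
      using False r deg_N by linarith
    with False show ?thesis by (simp add: coeff_eq_0)
  qed
  ultimately show ?thesis
    unfolding rhs_eq coeff_add coeff_smult top[OF order_trans[OF B r]] by simp
qed

lemma eq_0: "eq 0 \<alpha> \<beta> = s d * \<alpha> + lead_coeff N"
proof -
  have "2 * d + degree N - 0 = d + M" using deg_N by simp
  then show ?thesis
    unfolding eq_def by (simp only:) (simp add: coeff_rhs_top coeff_unknown_monic)
qed

text \<open>With D = B - B' the factor B B(x + 1) changes by D B(x + 1) + D(x + 1) B', whose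
  coefficient at x^(2d - i) is 2 (\<beta> i - \<beta>' i) because B and B' are monic. The term with
  N' cancels, and \<open>top\<close> with r = d - i handles E and F.\<close>

lemma eq_diff:
  assumes i: "i \<in> {1..d}" and agree: "\<And>j. j \<in> {1..<i} \<Longrightarrow> \<beta> j = \<beta>' j"
  shows "eq i \<alpha> \<beta> - eq i \<alpha> \<beta>' = (2 * lead_coeff N + \<alpha> * s (d - i)) * (\<beta> i - \<beta>' i)"
proof -
  define B B' where "B = unknown_monic d \<beta>" and "B' = unknown_monic d \<beta>'"
  define D where "D = B - B'"
  have idx: "2 * d + degree N - i = (d - i) + M" "(d - i) + M = (d - i) + d + degree N"
    using i deg_N by auto
  have D_deg: "degree D \<le> d - i"
  proof (rule degree_le, intro allI impI)
    fix n assume "d - i < n"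
    then have "\<beta> (d - n) = \<beta>' (d - n)" if "n < d"
      using that i by (intro agree) auto
    then show "coeff D n = 0"
      by (auto simp: D_def B_def B'_def coeff_unknown_monic)
  qed
  have D_coeff: "coeff D (d - i) = \<beta> i - \<beta>' i"
    using i by (auto simp: D_def B_def B'_def coeff_unknown_monic)
  have BB: "degree B = d" "degree B' = d" "coeff B d = 1" "coeff B' d = 1"
    by (simp_all add: B_def B'_def coeff_unknown_monic)
  have sh: "shift D = shift B - shift B'"
    by (simp add: D_def pcompose_diff)
  have split: "rhs \<alpha> B - rhs \<alpha> B' = (D * shift B + shift D * B') * N + smult \<alpha> (D * E + shift D * F)"
    unfolding rhs_eq sh unfolding D_def by (simp add: algebra_simps smult_diff_right smult_add_right)
  have "degree (D * shift B + shift D * B') \<le> (d - i) + d"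
    using D_deg BB degree_mult_le[of D "shift B"] degree_mult_le[of "shift D" B']
    by (intro degree_add_le) auto
  then have "coeff ((D * shift B + shift D * B') * N) ((d - i) + d + degree N)
      = coeff (D * shift B + shift D * B') ((d - i) + d) * lead_coeff N"
    by (intro coeff_mult_top) auto
  also have "coeff (D * shift B + shift D * B') ((d - i) + d) = 2 * coeff D (d - i)"
    using D_deg BB by (simp add: coeff_mult_top coeff_shift_top)
  finally have quadratic: "coeff ((D * shift B + shift D * B') * N) ((d - i) + M)
      = 2 * coeff D (d - i) * lead_coeff N"
    unfolding idx(2) .
  have "coeff (rhs \<alpha> B - rhs \<alpha> B') ((d - i) + M)
      = 2 * coeff D (d - i) * lead_coeff N + \<alpha> * (coeff D (d - i) * s (d - i))"
    unfolding split coeff_add coeff_smult quadratic top[OF D_deg] ..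
  then show ?thesis
    unfolding eq_def B_def[symmetric] B'_def[symmetric] idx(1) D_coeff
    by (simp add: algebra_simps)
qed

lemma triangular: "triangular_nonzero_diagonal d eq"
proof (rule triangularI[where g = "\<lambda>i \<alpha>. 2 * lead_coeff N + \<alpha> * s (d - i)"])
  fix i \<alpha> assume i: "i \<in> {1..d}" and \<alpha>: "s d * \<alpha> + lead_coeff N = 0"
  have "\<alpha> \<noteq> 0" using \<alpha> N_nonzero by auto
  have "2 * lead_coeff N + \<alpha> * s (d - i) = \<alpha> * (s (d - i) - 2 * s d)"
    using \<alpha> by algebra
  with \<open>\<alpha> \<noteq> 0\<close> s_diff[OF i] show "2 * lead_coeff N + \<alpha> * s (d - i) \<noteq> 0" by simp
qed (use eq_0 s_d eq_diff in auto)

text \<open>The equations kill the coefficients of x^M, ..., x^(d + M), and all higher ones vanish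
  anyway; this is the degree bound for the next N. M > 0 matters because the polynomial may be zero,
  with \<open>degree 0 = 0\<close>.\<close>

lemma degree_rhs_less:
  assumes "0 < M" and sol: "\<And>i. i \<le> d \<Longrightarrow> eq i \<alpha> \<beta> = 0"
  shows "degree (rhs \<alpha> (unknown_monic d \<beta>)) < M"
proof -
  have "coeff (rhs \<alpha> (unknown_monic d \<beta>)) n = 0" if "M \<le> n" for n
  proof (cases "n \<le> d + M")
    case True
    then have "2 * d + degree N - (d + M - n) = n" "d + M - n \<le> d"
      using that deg_N by auto
    with sol[of "d + M - n"] show ?thesis by (simp add: eq_def)
  next
    case False
    define r where "r = n - M"
    have "n = r + M" "d < r" using False that by (auto simp: r_def)
    then show ?thesis by (simp add: coeff_rhs_top coeff_unknown_monic)
  qed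
  with \<open>0 < M\<close> show ?thesis by (metis degree_lessI)
qed

end

section \<open>The invariant\<close>

text \<open>A strict bound by this value is the bound (i) on the degree of N; it is also the M of
  \<open>step_system\<close>.\<close>

definition bound_deg :: "rat \<Rightarrow> nat \<Rightarrow> nat" where
  "bound_deg \<epsilon> m = (if \<epsilon> = -1 then m else m - 1)"

text \<open>The strict bounds force 0 < m, so the degree clauses also say that E and F are
  non-zero.\<close>

definition invariant :: "rat \<Rightarrow> nat \<Rightarrow> rat poly \<Rightarrow> rat poly \<Rightarrow> rat poly \<Rightarrow> rat poly \<Rightarrow> bool" where
  "invariant \<epsilon> m N' N E F \<longleftrightarrow>
     degree N' < bound_deg \<epsilon> m \<and> degree N < bound_deg \<epsilon> m \<and> degree E = m \<and> degree F = m
     \<and> coeff F m = - \<epsilon> * coeff E m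
     \<and> (\<epsilon> = 1 \<longrightarrow> coeff E m * (coeff E (m - 1) + coeff F (m - 1)) \<le> 0)"

text \<open>The multiplier s(r) of \<open>coeff D r\<close> in the coefficient of x^(r + M) in D E +
  D(x + 1) F.\<close>

definition diag :: "rat \<Rightarrow> nat \<Rightarrow> rat poly \<Rightarrow> rat poly \<Rightarrow> nat \<Rightarrow> rat" where
  "diag \<epsilon> m E F r = (if \<epsilon> = -1 then 2 * coeff E m
     else coeff E (m - 1) + coeff F (m - 1) - of_nat r * coeff E m)"

text \<open>If \<sigma> = n e, then e \<sigma> = n e^2 > 0. Used with n = d for the first diagonal
  entry and with n = d + i for the others.\<close>

lemma opposite_sign_nonzero:
  fixes e \<sigma> :: rat
  assumes "e \<noteq> 0" "e * \<sigma> \<le> 0" "0 < n"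
  shows "\<sigma> - of_nat n * e \<noteq> 0"
proof
  assume "\<sigma> - of_nat n * e = 0"
  then have "e * \<sigma> = of_nat n * (e * e)" by simp
  moreover have "0 < e * e" using assms(1) by (simp add: less_le)
  then have "0 < of_nat n * (e * e)"
    by (rule mult_pos_pos[rotated]) (simp add: assms(3))
  ultimately show False using assms(2) by linarith
qed

lemma invariant_step_system:
  assumes eps: "\<epsilon> = 1 \<or> \<epsilon> = -1" and inv: "invariant \<epsilon> m N' N E F" and "N \<noteq> 0"
  shows "step_system N N' E F (bound_deg \<epsilon> m - degree N) (bound_deg \<epsilon> m) (diag \<epsilon> m E F)"
proof -
  define M d where "M = bound_deg \<epsilon> m" and "d = M - degree N"
  have m: "0 < M" "0 < m" "degree N < M" "0 < d"
    using inv by (auto simp: M_def d_def invariant_def bound_deg_def split: if_splits)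
  have e0: "coeff E m \<noteq> 0"
    using inv m by (metis invariant_def degree_0 leading_coeff_0_iff less_irrefl)
  have nonneg: "coeff E m * (coeff E (m - 1) + coeff F (m - 1)) \<le> 0" if "\<epsilon> = 1"
    using inv that by (simp add: invariant_def)
  show ?thesis
    unfolding M_def[symmetric] d_def[symmetric]
  proof
    show "N \<noteq> 0" by fact
    show "d + degree N = M" using m by (simp add: d_def)
    show "degree N' < M" using inv by (simp add: invariant_def M_def)
    show "coeff (D * E) (r + M) + coeff (shift D * F) (r + M) = coeff D r * diag \<epsilon> m E F r" if "degree D \<le> r" for D r
    proof (cases "\<epsilon> = -1")
      case True
      then have "M = m" by (simp add: M_def bound_deg_def)
      have "degree E \<le> m" "degree F \<le> m" "coeff F m = coeff E m"
        using inv True by (auto simp: invariant_def)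
      with coeff_mult_shift_add_top[OF that this(1,2)] True show ?thesis
        by (simp add: diag_def \<open>M = m\<close>)
    next
      case False
      with eps have "\<epsilon> = 1" by simp
      then have M: "m = Suc M" using m by (auto simp: M_def bound_deg_def)
      have "coeff F (Suc M) = - coeff E (Suc M)" "degree E \<le> Suc M" "degree F \<le> Suc M"
        using inv M \<open>\<epsilon> = 1\<close> by (auto simp: invariant_def)
      from coeff_mult_shift_add_second[OF that this(2,3,1)] show ?thesis
        using \<open>\<epsilon> = 1\<close> M by (simp add: diag_def)
    qed
    \<comment> \<open>For \<epsilon> = 1 positivity of d is essential: the sum of the second
      coefficients may be zero, as it is for \<open>E\<^sub>0\<close> = f and
      \<open>F\<^sub>0\<close> = -f.\<close>
    show "diag \<epsilon> m E F d \<noteq> 0"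
      using e0 nonneg eps m opposite_sign_nonzero[OF e0 nonneg, of d] by (auto simp: diag_def)
    show "diag \<epsilon> m E F (d - i) \<noteq> 2 * diag \<epsilon> m E F d" if "i \<in> {1..d}" for i
    proof (cases "\<epsilon> = -1")
      case True
      with e0 show ?thesis by (simp add: diag_def)
    next
      case False
      with eps have "\<epsilon> = 1" by simp
      from opposite_sign_nonzero[OF e0 nonneg[OF this], of "d + i"] m
      show ?thesis using that \<open>\<epsilon> = 1\<close> by (auto simp: diag_def of_nat_diff algebra_simps)
    qed
  qed
qed

text \<open>Let e be the top coefficient of E and \<nu> that of N. For \<epsilon> = -1 the first
  equation gives \<nu> = -2 e \<alpha>, so both new top coefficients are -\<alpha> e. For \<epsilon>
  = 1 the products with N end at x^(m - 1), so the top coefficients of E and F are exchanged and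
  scaled by \<alpha>.\<close>

lemma invariant_preserved:
  assumes eps: "\<epsilon> = 1 \<or> \<epsilon> = -1" and inv: "invariant \<epsilon> m N' N E F" and "N \<noteq> 0"
    and B: "degree B = d" "lead_coeff B = 1"
    and d: "d = bound_deg \<epsilon> m - degree N"
    and \<alpha>: "diag \<epsilon> m E F d * \<alpha> + lead_coeff N = 0"
    and N2: "degree N2 < bound_deg \<epsilon> m"
  shows "invariant \<epsilon> m N N2 (B * N + smult \<alpha> F) (shift B * N + smult \<alpha> E)"
proof -
  let ?E = "B * N + smult \<alpha> F" and ?F = "shift B * N + smult \<alpha> E"
  define M \<nu> where "M = bound_deg \<epsilon> m" and "\<nu> = lead_coeff N"
  have M: "M = d + degree N" "0 < m" "M \<le> m" "degree N < M" "0 < M"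
    using inv by (auto simp: M_def d invariant_def bound_deg_def split: if_splits)
  have e0: "coeff E m \<noteq> 0"
    using inv M by (metis invariant_def degree_0 leading_coeff_0_iff less_irrefl)
  have EF: "degree E = m" "degree F = m" "coeff F m = - \<epsilon> * coeff E m"
    using inv by (auto simp: invariant_def)
  have "\<nu> \<noteq> 0" using \<open>N \<noteq> 0\<close> by (simp add: \<nu>_def)
  with \<alpha> have "\<alpha> \<noteq> 0" by (auto simp: \<nu>_def)
  have BN: "coeff (B * N) M = \<nu>" "coeff (shift B * N) M = \<nu>"
    using B unfolding M(1) by (simp_all add: coeff_mult_top coeff_shift_top \<nu>_def)
  have BN_deg: "degree (B * N) \<le> M" "degree (shift B * N) \<le> M"
    using degree_mult_le[of B N] degree_mult_le[of "shift B" N] B M by auto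
  have "degree ?E \<le> m" "degree ?F \<le> m"
    using BN_deg M EF by (auto intro!: degree_add_le degree_smult_le[THEN order_trans])
  note le = this
  have claim: "coeff ?E m \<noteq> 0 \<and> coeff ?F m = - \<epsilon> * coeff ?E m
     \<and> (\<epsilon> = 1 \<longrightarrow> coeff ?E m * (coeff ?E (m - 1) + coeff ?F (m - 1)) \<le> 0)"
  proof (cases "\<epsilon> = -1")
    case True
    then have "M = m" by (simp add: M_def bound_deg_def)
    have \<nu>: "\<nu> = - 2 * coeff E m * \<alpha>"
      using \<alpha> True by (simp add: diag_def \<nu>_def)
    have "coeff ?E m = - coeff E m * \<alpha>" "coeff ?F m = - coeff E m * \<alpha>"
      using BN True EF(3) \<nu> \<open>M = m\<close> by simp_all
    with True e0 \<open>\<alpha> \<noteq> 0\<close> show ?thesis by simp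
  next
    case False
    with eps have "\<epsilon> = 1" by simp
    then have m: "m = Suc M" using M by (auto simp: M_def bound_deg_def)
    define e \<sigma> where "e = coeff E m" and "\<sigma> = coeff E M + coeff F M"
    have \<nu>: "\<nu> = \<alpha> * (of_nat d * e - \<sigma>)"
      using \<alpha> \<open>\<epsilon> = 1\<close> m by (simp add: diag_def \<nu>_def e_def \<sigma>_def algebra_simps)
    have "coeff (B * N) m = 0" "coeff (shift B * N) m = 0"
      using BN_deg m by (auto intro!: coeff_eq_0)
    then have top: "coeff ?E m = - \<alpha> * e" "coeff ?F m = \<alpha> * e"
      using EF(3) \<open>\<epsilon> = 1\<close> by (simp_all add: e_def)
    have "coeff ?E M + coeff ?F M = 2 * \<nu> + \<alpha> * \<sigma>"
      using BN by (simp add: \<sigma>_def algebra_simps)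
    then have "coeff ?E m * (coeff ?E M + coeff ?F M) = - \<alpha> * e * (2 * \<nu> + \<alpha> * \<sigma>)"
      by (simp only: top)
    \<comment> \<open>Substituting \<nu> splits the product into two non-positive terms: the first
      by the old sign condition, the second as a non-positive multiple of a square.\<close>
    also have "\<dots> = \<alpha>\<^sup>2 * (e * \<sigma>) - 2 * of_nat d * (\<alpha> * e)\<^sup>2"
      by (simp add: \<nu> algebra_simps power2_eq_square)
    also have "\<dots> \<le> 0"
    proof -
      have "e * \<sigma> \<le> 0"
        using inv \<open>\<epsilon> = 1\<close> m by (simp add: invariant_def e_def \<sigma>_def)
      then have "\<alpha>\<^sup>2 * (e * \<sigma>) \<le> 0" by (simp add: mult_nonneg_nonpos)
      moreover have "0 \<le> 2 * of_nat d * (\<alpha> * e)\<^sup>2" by simp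
      ultimately show ?thesis by linarith
    qed
    finally show ?thesis
      using top \<open>\<epsilon> = 1\<close> \<open>\<alpha> \<noteq> 0\<close> e0 m by (simp add: e_def)
  qed
  moreover from this eps have "coeff ?F m \<noteq> 0" by auto
  ultimately have "degree ?E = m" "degree ?F = m"
    using le le_degree by (metis antisym)+
  with claim N2 M(4) show ?thesis
    by (simp add: invariant_def M_def)
qed

section \<open>Recurrences\<close>

text \<open>Lets the sequences be updated at n + 1 without disturbing quantities of index up to
  n.\<close>

lemma cf_cong:
  assumes "\<And>j. j \<in> {1..nat k} \<Longrightarrow> a j = a' j \<and> b j = b' j"
  shows "cf_p a b k = cf_p a' b' k" "cf_q a b k = cf_q a' b' k"
proof -
  have "cf_p a b k = cf_p a' b' k \<and> cf_q a b k = cf_q a' b' k"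
    using assms
  proof (induction "nat (k + 1)" arbitrary: k rule: less_induct)
    case less
    show ?case
    proof (cases "k \<le> 0")
      case True
      then show ?thesis by (simp add: cf_p.simps[of _ _ k] cf_q.simps[of _ _ k])
    next
      case False
      have 1: "cf_p a b (k - 1) = cf_p a' b' (k - 1) \<and> cf_q a b (k - 1) = cf_q a' b' (k - 1)"
        using False less.prems by (intro less.hyps) auto
      have 2: "cf_p a b (k - 2) = cf_p a' b' (k - 2) \<and> cf_q a b (k - 2) = cf_q a' b' (k - 2)"
        using False less.prems by (intro less.hyps) auto
      have 3: "a (nat k) = a' (nat k)" "b (nat k) = b' (nat k)"
        using False less.prems[of "nat k"] by auto
      from 1 2 3 show ?thesis
        by (simp add: cf_p.simps[of _ _ k] cf_q.simps[of _ _ k])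
    qed
  qed
  then show "cf_p a b k = cf_p a' b' k" "cf_q a b k = cf_q a' b' k" by auto
qed

lemma cf_NEF_cong:
  assumes "\<And>j. j \<in> {1..nat k} \<Longrightarrow> a j = a' j \<and> b j = b' j"
  shows "cf_N \<epsilon> f a b k = cf_N \<epsilon> f a' b' k" "cf_E \<epsilon> f a b k = cf_E \<epsilon> f a' b' k"
    "cf_F \<epsilon> f a b k = cf_F \<epsilon> f a' b' k"
proof -
  have prev: "\<And>j. j \<in> {1..nat (k - 1)} \<Longrightarrow> a j = a' j \<and> b j = b' j"
    using assms by auto
  show "cf_N \<epsilon> f a b k = cf_N \<epsilon> f a' b' k" "cf_E \<epsilon> f a b k = cf_E \<epsilon> f a' b' k"
    "cf_F \<epsilon> f a b k = cf_F \<epsilon> f a' b' k"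
    by (simp_all only: cf_N_def cf_E_def cf_F_def cf_cong[OF assms] cf_cong[OF prev])
qed

lemma cf_pq_Suc:
  "cf_p a b (int (Suc n)) = b (Suc n) * cf_p a b (int n) + smult (a (Suc n)) (cf_p a b (int n - 1))"
  "cf_q a b (int (Suc n)) = b (Suc n) * cf_q a b (int n) + smult (a (Suc n)) (cf_q a b (int n - 1))"
proof -
  have "nat (int (Suc n)) = Suc n" "int (Suc n) - 1 = int n" "int (Suc n) - 2 = int n - 1"
    "\<not> int (Suc n) \<le> -1" "int (Suc n) \<noteq> 0" by auto
  then show
    "cf_p a b (int (Suc n)) = b (Suc n) * cf_p a b (int n) + smult (a (Suc n)) (cf_p a b (int n - 1))"
    "cf_q a b (int (Suc n)) = b (Suc n) * cf_q a b (int n) + smult (a (Suc n)) (cf_q a b (int n - 1))"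
    by (simp_all only: cf_p.simps[of _ _ "int (Suc n)"] cf_q.simps[of _ _ "int (Suc n)"] if_False)
qed

text \<open>All three are values of one bilinear form H(i, j) = q_i q_j(x + 1) - f (p_i q_j(x + 1) -
  \<epsilon> p_j(x + 1) q_i): N_k = H(k, k), E_k = H(k, k - 1), F_k = H(k - 1, k). Expanding the
  index n + 1 in one slot gives the first two identities, in both slots the third.\<close>

lemma cf_recurrences:
  "cf_E \<epsilon> f a b (int (Suc n)) = b (Suc n) * cf_N \<epsilon> f a b (int n) + smult (a (Suc n)) (cf_F \<epsilon> f a b (int n))"
  "cf_F \<epsilon> f a b (int (Suc n)) = shift (b (Suc n)) * cf_N \<epsilon> f a b (int n) + smult (a (Suc n)) (cf_E \<epsilon> f a b (int n))"
  "cf_N \<epsilon> f a b (int (Suc n)) = tcf_rhs \<epsilon> f a b (Suc n) (a (Suc n)) (b (Suc n))"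
proof -
  have sub: "int (Suc n) - 1 = int n" "int (Suc n) - 2 = int n - 1" by auto
  note defs = cf_N_def cf_E_def cf_F_def tcf_rhs_def sub cf_pq_Suc
    pcompose_add pcompose_mult pcompose_smult
  show "cf_E \<epsilon> f a b (int (Suc n)) = b (Suc n) * cf_N \<epsilon> f a b (int n) + smult (a (Suc n)) (cf_F \<epsilon> f a b (int n))"
    "cf_F \<epsilon> f a b (int (Suc n)) = shift (b (Suc n)) * cf_N \<epsilon> f a b (int n) + smult (a (Suc n)) (cf_E \<epsilon> f a b (int n))"
    "cf_N \<epsilon> f a b (int (Suc n)) = tcf_rhs \<epsilon> f a b (Suc n) (a (Suc n)) (b (Suc n))"
    unfolding defs
    by (simp_all add: algebra_simps smult_add_right smult_diff_right power2_eq_square)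
qed

section \<open>Running the algorithm\<close>

definition cf_invariant :: "rat \<Rightarrow> rat poly \<Rightarrow> (nat \<Rightarrow> rat) \<Rightarrow> (nat \<Rightarrow> rat poly) \<Rightarrow> nat \<Rightarrow> bool" where
  "cf_invariant \<epsilon> f a b n \<longleftrightarrow> invariant \<epsilon> (degree f) (cf_N \<epsilon> f a b (int n - 1)) (cf_N \<epsilon> f a b (int n))
     (cf_E \<epsilon> f a b (int n)) (cf_F \<epsilon> f a b (int n))"

text \<open>The bounds on \<open>degree f\<close> make \<open>bound_deg\<close> positive, as N_(-1)
  = 0 and N_0 = 1 require, both having \<open>degree\<close> 0. For \<epsilon> = 1 the sign
  condition holds because E_0 + F_0 = 0.\<close>

lemma cf_invariant_0:
  assumes "\<epsilon> = 1 \<or> \<epsilon> = -1" "\<epsilon> = -1 \<Longrightarrow> degree f \<ge> 1" "\<epsilon> = 1 \<Longrightarrow> degree f \<ge> 2"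
  shows "cf_invariant \<epsilon> f a b 0"
proof -
  have "cf_N \<epsilon> f a b (-1) = 0" "cf_N \<epsilon> f a b 0 = 1"
    "cf_E \<epsilon> f a b 0 = smult \<epsilon> f" "cf_F \<epsilon> f a b 0 = - f"
    by (simp_all add: cf_N_def cf_E_def cf_F_def cf_p.simps[of a b 0] cf_p.simps[of a b "-1"]
      cf_q.simps[of a b 0] cf_q.simps[of a b "-1"] pcompose_1)
  with assms show ?thesis
    by (auto simp: cf_invariant_def invariant_def bound_deg_def)
qed

lemma tcf_step_succeeds:
  assumes eps: "\<epsilon> = 1 \<or> \<epsilon> = -1" and inv: "cf_invariant \<epsilon> f a b n"
    and N: "cf_N \<epsilon> f a b (int n) \<noteq> 0"
  shows "cf_E \<epsilon> f a b (int n) \<noteq> 0" "tcf_deg \<epsilon> f a b (Suc n) \<ge> 0"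
    "triangular_nonzero_diagonal (nat (tcf_deg \<epsilon> f a b (Suc n))) (tcf_eq \<epsilon> f a b (Suc n))"
    "\<exists>!s. tcf_solution \<epsilon> f a b (Suc n) s"
    "\<exists>\<alpha> B. tcf_step \<epsilon> f (Suc n) (Running a b) = Running (a(Suc n := \<alpha>)) (b(Suc n := B))
       \<and> cf_invariant \<epsilon> f (a(Suc n := \<alpha>)) (b(Suc n := B)) (Suc n)"
proof -
  define m N\<^sub>n E\<^sub>n F\<^sub>n where "m = degree f" and "N\<^sub>n = cf_N \<epsilon> f a b (int n)"
    and "E\<^sub>n = cf_E \<epsilon> f a b (int n)" and "F\<^sub>n = cf_F \<epsilon> f a b (int n)"
  define N' where "N' = cf_N \<epsilon> f a b (int n - 1)"
  define M where "M = bound_deg \<epsilon> m"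
  define d where "d = M - degree N\<^sub>n"
  have I: "invariant \<epsilon> m N' N\<^sub>n E\<^sub>n F\<^sub>n"
    using inv by (simp add: cf_invariant_def m_def N\<^sub>n_def E\<^sub>n_def F\<^sub>n_def N'_def)
  have Nn: "N\<^sub>n \<noteq> 0" using N by (simp add: N\<^sub>n_def)
  interpret step_system N\<^sub>n N' E\<^sub>n F\<^sub>n d M "diag \<epsilon> m E\<^sub>n F\<^sub>n"
    using invariant_step_system[OF eps I Nn] by (simp add: d_def M_def)
  have m: "0 < m" "0 < M" "degree E\<^sub>n = m" "degree N\<^sub>n < M"
    using I by (auto simp: M_def invariant_def bound_deg_def split: if_splits)
  show E: "cf_E \<epsilon> f a b (int n) \<noteq> 0"
    using m by (auto simp: E\<^sub>n_def)
  have sub: "int (Suc n) - 1 = int n" "int (Suc n) - 2 = int n - 1" by auto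
  \<comment> \<open>E has degree m, so both cases of \<open>tcf_deg\<close> give M minus the degree
    of N, and the bound on N keeps the subtraction of naturals exact.\<close>
  have deg: "tcf_deg \<epsilon> f a b (Suc n) = int d"
    using m eps unfolding tcf_deg_def sub N\<^sub>n_def[symmetric] E\<^sub>n_def[symmetric]
    by (auto simp: d_def M_def bound_deg_def of_nat_diff)
  then show "tcf_deg \<epsilon> f a b (Suc n) \<ge> 0" by simp
  have rhs: "tcf_rhs \<epsilon> f a b (Suc n) = rhs"
    by (intro ext, unfold tcf_rhs_def rhs_def sub) (simp add: N\<^sub>n_def N'_def E\<^sub>n_def F\<^sub>n_def)
  have eq: "tcf_eq \<epsilon> f a b (Suc n) = eq"
    by (intro ext, unfold tcf_eq_def eq_def sub rhs deg) (simp add: N\<^sub>n_def)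
  show "triangular_nonzero_diagonal (nat (tcf_deg \<epsilon> f a b (Suc n))) (tcf_eq \<epsilon> f a b (Suc n))"
    using triangular by (simp add: deg eq)
  have sol_iff: "tcf_solution \<epsilon> f a b (Suc n) = (\<lambda>(\<alpha>, \<beta>).
      (\<forall>i. i \<notin> {1..d} \<longrightarrow> \<beta> i = 0) \<and> (\<forall>i\<le>d. eq i \<alpha> \<beta> = 0))"
    unfolding tcf_solution_def sub eq deg using E by simp
  show ex1: "\<exists>!s. tcf_solution \<epsilon> f a b (Suc n) s"
    using triangular_unique_solution[OF triangular] unfolding sol_iff .
  obtain \<alpha> \<beta> where the: "(THE s. tcf_solution \<epsilon> f a b (Suc n) s) = (\<alpha>, \<beta>)"
    by fastforce
  with theI'[OF ex1] have sol: "\<And>i. i \<le> d \<Longrightarrow> eq i \<alpha> \<beta> = 0"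
    by (simp add: sol_iff)
  define B where "B = unknown_monic d \<beta>"
  define a' b' where "a' = a(Suc n := \<alpha>)" and "b' = b(Suc n := B)"
  have step: "tcf_step \<epsilon> f (Suc n) (Running a b) = Running a' b'"
    using N ex1 the deg unfolding tcf_step.simps sub by (simp add: a'_def b'_def B_def)
  \<comment> \<open>The update at n + 1 leaves indices up to n alone, so the old quantities can be
    expressed with the new sequences.\<close>
  have old: "cf_N \<epsilon> f a' b' (int n) = N\<^sub>n" "cf_E \<epsilon> f a' b' (int n) = E\<^sub>n"
    "cf_F \<epsilon> f a' b' (int n) = F\<^sub>n" "cf_N \<epsilon> f a' b' (int n - 1) = N'"
    unfolding N\<^sub>n_def E\<^sub>n_def F\<^sub>n_def N'_def a'_def b'_def
    by (rule cf_NEF_cong; auto)+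
  have new: "cf_E \<epsilon> f a' b' (int (Suc n)) = B * N\<^sub>n + smult \<alpha> F\<^sub>n"
    "cf_F \<epsilon> f a' b' (int (Suc n)) = shift B * N\<^sub>n + smult \<alpha> E\<^sub>n"
    "cf_N \<epsilon> f a' b' (int (Suc n)) = rhs \<alpha> B"
    unfolding cf_recurrences tcf_rhs_def sub old rhs_def by (simp_all add: a'_def b'_def)
  have "invariant \<epsilon> m N\<^sub>n (rhs \<alpha> B) (B * N\<^sub>n + smult \<alpha> F\<^sub>n) (shift B * N\<^sub>n + smult \<alpha> E\<^sub>n)"
  proof (rule invariant_preserved[OF eps I Nn])
    show "degree B = d" "lead_coeff B = 1"
      by (simp_all add: B_def coeff_unknown_monic)
    show "d = bound_deg \<epsilon> m - degree N\<^sub>n" by (simp add: d_def M_def)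
    show "diag \<epsilon> m E\<^sub>n F\<^sub>n d * \<alpha> + lead_coeff N\<^sub>n = 0"
      using sol[of 0] eq_0 by simp
    show "degree (rhs \<alpha> B) < bound_deg \<epsilon> m"
      using degree_rhs_less[OF m(2) sol] by (simp add: B_def M_def)
  qed
  then have "cf_invariant \<epsilon> f a' b' (Suc n)"
    unfolding cf_invariant_def sub new old m_def .
  with step show "\<exists>\<alpha> B. tcf_step \<epsilon> f (Suc n) (Running a b) = Running (a(Suc n := \<alpha>)) (b(Suc n := B))
       \<and> cf_invariant \<epsilon> f (a(Suc n := \<alpha>)) (b(Suc n := B)) (Suc n)"
    unfolding a'_def b'_def by blast
qed

text \<open>Holds because \<open>Stopped\<close> and \<open>Failed\<close> are absorbing and a
  vanishing N leads to \<open>Stopped\<close>.\<close>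

lemma tcf_SucE:
  assumes "tcf \<epsilon> f (Suc n) = Running a b"
  obtains a\<^sub>0 b\<^sub>0 where "tcf \<epsilon> f n = Running a\<^sub>0 b\<^sub>0" "cf_N \<epsilon> f a\<^sub>0 b\<^sub>0 (int n) \<noteq> 0"
  using assms by (cases "tcf \<epsilon> f n") (auto split: if_splits)

lemma tcf_invariant:
  assumes "\<epsilon> = 1 \<or> \<epsilon> = -1" "\<epsilon> = -1 \<Longrightarrow> degree f \<ge> 1" "\<epsilon> = 1 \<Longrightarrow> degree f \<ge> 2"
    and "tcf \<epsilon> f n = Running a b"
  shows "cf_invariant \<epsilon> f a b n"
  using assms(4)
proof (induction n arbitrary: a b)
  case 0
  then show ?case using cf_invariant_0 assms(1-3) by blast
next
  case (Suc n)
  from tcf_SucE[OF Suc.prems] obtain a\<^sub>0 b\<^sub>0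
    where *: "tcf \<epsilon> f n = Running a\<^sub>0 b\<^sub>0" "cf_N \<epsilon> f a\<^sub>0 b\<^sub>0 (int n) \<noteq> 0"
    by blast
  from tcf_step_succeeds(5)[OF assms(1) Suc.IH[OF *(1)] *(2)] Suc.prems *(1)
  show ?case by (auto simp del: tcf_step.simps)
qed

lemma tcf_never_terminates:
  assumes "\<epsilon> = 1 \<or> \<epsilon> = -1" "\<epsilon> = -1 \<Longrightarrow> degree f \<ge> 1" "\<epsilon> = 1 \<Longrightarrow> degree f \<ge> 2"
    and nonzero: "\<And>n a b. tcf \<epsilon> f n = Running a b \<Longrightarrow> cf_N \<epsilon> f a b (int n) \<noteq> 0"
  shows "\<exists>a b. \<forall>n. \<exists>a' b'. tcf \<epsilon> f n = Running a' b' \<and> (\<forall>k \<in> {1..n}. a' k = a k \<and> b' k = b k)"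
proof -
  have step: "\<exists>\<alpha> B. tcf \<epsilon> f (Suc n) = Running (a(Suc n := \<alpha>)) (b(Suc n := B))"
    if "tcf \<epsilon> f n = Running a b" for n a b
    using tcf_step_succeeds(5)[OF assms(1) tcf_invariant[OF assms(1-3) that] nonzero[OF that]] that
    by (auto simp del: tcf_step.simps)
  have "\<exists>a b. tcf \<epsilon> f n = Running a b" for n
  proof (induction n)
    case (Suc n)
    then show ?case using step by blast
  qed simp
  then obtain a b where ab: "\<And>n. tcf \<epsilon> f n = Running (a n) (b n)" by metis
  have Suc: "a (Suc n) k = a n k \<and> b (Suc n) k = b n k" if "k \<le> n" for n k
    using step[OF ab[of n]] ab[of "Suc n"] that by auto
  \<comment> \<open>Step n + 1 changes only entry n + 1, so entry k is final from state k on; the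
    diagonals \<open>a k k\<close> and \<open>b k k\<close> therefore give the limiting
    sequences.\<close>
  have stable: "a n k = a k k \<and> b n k = b k k" if "k \<le> n" for n k
    using that by (induction rule: dec_induct) (simp_all add: Suc)
  show ?thesis
  proof (intro exI allI conjI ballI)
    fix n k
    show "tcf \<epsilon> f n = Running (a n) (b n)" by (rule ab)
    assume "k \<in> {1..n}"
    then show "a n k = a k k" "b n k = b k k"
      using stable[of k n] by auto
  qed
qed

theorem theorem4p1:
  fixes \<epsilon> :: rat and f :: "rat poly" and m :: nat
  assumes "\<epsilon> = 1 \<or> \<epsilon> = -1"
    and "degree f = m"
    and "\<epsilon> = -1 \<Longrightarrow> m \<ge> 1"
    and "\<epsilon> = 1 \<Longrightarrow> m \<ge> 2"
  shows
    "(\<forall>k \<ge> 1. \<forall>a b. tcf \<epsilon> f (k - 1) = Running a b \<and> cf_N \<epsilon> f a b (int k - 1) \<noteq> 0 \<longrightarrow>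
        cf_E \<epsilon> f a b (int k - 1) \<noteq> 0 \<and> tcf_deg \<epsilon> f a b k \<ge> 0
        \<and> triangular_nonzero_diagonal (nat (tcf_deg \<epsilon> f a b k)) (tcf_eq \<epsilon> f a b k)
        \<and> (\<exists>!s. tcf_solution \<epsilon> f a b k s)
        \<and> (\<exists>a' b'. tcf \<epsilon> f k = Running a' b'
            \<and> (\<epsilon> = -1 \<longrightarrow> degree (cf_N \<epsilon> f a' b' (int k)) \<le> m - 1)
            \<and> (\<epsilon> = 1 \<longrightarrow> degree (cf_N \<epsilon> f a' b' (int k)) \<le> m - 2)
            \<and> degree (cf_E \<epsilon> f a' b' (int k)) = m
            \<and> degree (cf_F \<epsilon> f a' b' (int k)) = m
            \<and> coeff (cf_F \<epsilon> f a' b' (int k)) m = - \<epsilon> * coeff (cf_E \<epsilon> f a' b' (int k)) m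
            \<and> (\<epsilon> = 1 \<longrightarrow>
                 coeff (cf_E \<epsilon> f a' b' (int k)) m
                 * (coeff (cf_E \<epsilon> f a' b' (int k)) (m - 1) + coeff (cf_F \<epsilon> f a' b' (int k)) (m - 1)) \<le> 0)))
     \<and> ((\<forall>n a b. tcf \<epsilon> f n = Running a b \<longrightarrow> cf_N \<epsilon> f a b (int n) \<noteq> 0) \<longrightarrow>
         (\<exists>a b. \<forall>n. \<exists>a' b'. tcf \<epsilon> f n = Running a' b'
            \<and> (\<forall>k \<in> {1..n}. a' k = a k \<and> b' k = b k)))"
proof (intro conjI allI impI)
  note hyps = assms(1,3,4)[folded assms(2)]
  show "\<exists>a b. \<forall>n. \<exists>a' b'. tcf \<epsilon> f n = Running a' b' \<and> (\<forall>k \<in> {1..n}. a' k = a k \<and> b' k = b k)"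
    if "\<forall>n a b. tcf \<epsilon> f n = Running a b \<longrightarrow> cf_N \<epsilon> f a b (int n) \<noteq> 0"
    using tcf_never_terminates[OF hyps] that by blast
  fix k a b
  assume k: "k \<ge> (1 :: nat)"
    and *: "tcf \<epsilon> f (k - 1) = Running a b \<and> cf_N \<epsilon> f a b (int k - 1) \<noteq> 0"
  from k obtain n where n: "k = Suc n" by (cases k) auto
  have run: "tcf \<epsilon> f n = Running a b" and N: "cf_N \<epsilon> f a b (int n) \<noteq> 0"
    using * by (simp_all add: n)
  have inv: "cf_invariant \<epsilon> f a b n"
    by (rule tcf_invariant) (use hyps run in auto)
  note step = tcf_step_succeeds[OF assms(1) inv N]
  show "cf_E \<epsilon> f a b (int k - 1) \<noteq> 0"
    using step(1) by (simp add: n)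
  show "tcf_deg \<epsilon> f a b k \<ge> 0"
    "triangular_nonzero_diagonal (nat (tcf_deg \<epsilon> f a b k)) (tcf_eq \<epsilon> f a b k)"
    "\<exists>!s. tcf_solution \<epsilon> f a b k s"
    unfolding n by (rule step)+
  from step(5) obtain a' b' where "tcf \<epsilon> f k = Running a' b'" "cf_invariant \<epsilon> f a' b' k"
    using run by (auto simp: n simp del: tcf_step.simps)
  then show "\<exists>a' b'. tcf \<epsilon> f k = Running a' b'
            \<and> (\<epsilon> = -1 \<longrightarrow> degree (cf_N \<epsilon> f a' b' (int k)) \<le> m - 1)
            \<and> (\<epsilon> = 1 \<longrightarrow> degree (cf_N \<epsilon> f a' b' (int k)) \<le> m - 2)
            \<and> degree (cf_E \<epsilon> f a' b' (int k)) = m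
            \<and> degree (cf_F \<epsilon> f a' b' (int k)) = m
            \<and> coeff (cf_F \<epsilon> f a' b' (int k)) m = - \<epsilon> * coeff (cf_E \<epsilon> f a' b' (int k)) m
            \<and> (\<epsilon> = 1 \<longrightarrow>
                 coeff (cf_E \<epsilon> f a' b' (int k)) m
                 * (coeff (cf_E \<epsilon> f a' b' (int k)) (m - 1) + coeff (cf_F \<epsilon> f a' b' (int k)) (m - 1)) \<le> 0)"
    by (intro exI[of _ a'] exI[of _ b'])
      (auto simp: cf_invariant_def invariant_def bound_deg_def assms(2))
qed

end
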